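(* Let $R$ be an associative ring (not necessarily unital), let $a_1,a_2,b,c\in R$, and suppose that $a_1$ and $a_2$ are both annihilator $(b,c)$-invertible with respective annihilator $(b,c)$-inverses $x_1,x_2$. Then $$x_1+x_2=x_1(a_1+a_2)x_2=x_2(a_1+a_2)x_1.$$
   Context: For $u\in R$ write ${}^{\circ}u=\{r\in R: ru=0\}$ and $u^{\circ}=\{r\in R: ur=0\}$. For $a,b,c\in R$, an element $x\in R$ is an annihilator $(b,c)$-inverse of $a$ if $xax=x$, $xab=b$, $cax=c$, ${}^{\circ}b\subseteq{}^{\circ}x$, and $c^{\circ}\subseteq x^{\circ}$; such $x$ is unique when it exists, and $a$ is then called annihilator $(b,c)$-invertible. *)

theory Defs
  imports Main
begin

text \<open>The type class \<^class>\<open>ring\<close> is the class of associative rings without any assumption of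
  a unit or of commutativity.\<close>

definition left_annihilator :: "'a::ring \<Rightarrow> 'a set" where
  "left_annihilator u = {r. r * u = 0}"

definition right_annihilator :: "'a::ring \<Rightarrow> 'a set" where
  "right_annihilator u = {r. u * r = 0}"

text \<open>\<open>annihilator_inverse b c a x\<close>: the element \<open>x\<close> is an annihilator \<open>(b, c)\<close>-inverse of \<open>a\<close>.\<close>

definition annihilator_inverse :: "'a::ring \<Rightarrow> 'a \<Rightarrow> 'a \<Rightarrow> 'a \<Rightarrow> bool" where
  "annihilator_inverse b c a x \<longleftrightarrow>
     x * a * x = x \<and> x * a * b = b \<and> c * a * x = c \<and>
     left_annihilator b \<subseteq> left_annihilator x \<and>
     right_annihilator c \<subseteq> right_annihilator x"

end

theory Submission
  imports Defs
begin

text \<open>If \<open>x\<close> and \<open>y\<close> are annihilator \<open>(b, c)\<close>-inverses of \<open>a\<close> and \<open>d\<close>, then \<open>x * a\<close> and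
  \<open>y * d\<close> both fix \<open>b\<close> from the left, and the annihilator condition on \<open>b\<close> carries this over
  to \<open>y\<close>, so that \<open>x * a\<close> acts on \<open>y\<close> as an identity; dually, \<open>d * y\<close> acts on \<open>x\<close> as an identity
  from the right. Hence \<open>x * (a + d) * y\<close> splits into \<open>x * a * y = y\<close> and \<open>x * d * y = x\<close>. The value
  \<open>x + y\<close> is symmetric, which gives the second equation by exchanging the roles.\<close>

text \<open>In a unital ring one would annihilate \<open>b\<close> by \<open>x * a - 1\<close>. Without a unit the left identity
  \<open>y * d\<close> of \<open>b\<close> takes the place of \<open>1\<close>; it is also a left identity of \<open>y\<close> itself.\<close>

lemma annihilator_inverse_absorb_left:
  assumes x: "annihilator_inverse b c a x" and y: "annihilator_inverse b c d y"
  shows "x * a * y = y"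
proof -
  have "(x * a - y * d) * b = 0"
    using x y by (simp add: annihilator_inverse_def left_diff_distrib)
  then have "(x * a - y * d) * y = 0"
    using y by (auto simp: annihilator_inverse_def left_annihilator_def)
  then show ?thesis
    using y by (simp add: annihilator_inverse_def left_diff_distrib)
qed

lemma annihilator_inverse_absorb_right:
  assumes x: "annihilator_inverse b c a x" and y: "annihilator_inverse b c d y"
  shows "x * d * y = x"
proof -
  have "c * (a * x - d * y) = 0"
    using x y by (simp add: annihilator_inverse_def right_diff_distrib flip: mult.assoc)
  then have "x * (a * x - d * y) = 0"
    using x by (auto simp: annihilator_inverse_def right_annihilator_def)
  then show ?thesis
    using x by (simp add: annihilator_inverse_def right_diff_distrib flip: mult.assoc)
qed

lemma annihilator_inverse_add:
  assumes "annihilator_inverse b c a x" and "annihilator_inverse b c d y"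
  shows "x * (a + d) * y = x + y"
  using annihilator_inverse_absorb_left[OF assms] annihilator_inverse_absorb_right[OF assms]
  by (simp add: distrib_left distrib_right add.commute)

theorem theorem4p3:
  fixes a1 a2 b c x1 x2 :: "'a::ring"
  assumes "annihilator_inverse b c a1 x1"
    and "annihilator_inverse b c a2 x2"
  shows "x1 + x2 = x1 * (a1 + a2) * x2 \<and> x1 * (a1 + a2) * x2 = x2 * (a1 + a2) * x1"
  using annihilator_inverse_add[OF assms] annihilator_inverse_add[OF assms(2,1)]
  by (simp add: add.commute)

end
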